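(* Suppose that for every $\alpha>0$ we have $pn^\alpha\to\infty$ as $n\to\infty$, and that $q\ln n\to\infty$, where $q=1-p$. Then for every $\varepsilon>0$ there exists $n_0$ such that for all $n\ge n_0$, both $u_3(n,p)$ and $u_3'(n,p)$ are at least $(2-\varepsilon)\log_{\frac{1}{1-p}}(np)$.
   Context: $G(n,p)$ is the Erdős–Rényi random graph on $n$ labelled vertices (vertex set $V$), each edge present independently with probability $p=p(n)$; $\mathbb{P}_{n,p}$ is the corresponding probability and $q=1-p$. A diameter graph in $\mathbb{R}^d$ is a graph $(V,E)$ with $V\subset\mathbb{R}^d$ finite and $E=\{\{\mathbf{x},\mathbf{y}\}\subseteq V: |\mathbf{x}-\mathbf{y}|=\operatorname{diam}V\}$, where $\operatorname{diam}V=\max_{\mathbf{x},\mathbf{y}\in V}|\mathbf{x}-\mathbf{y}|$ (Euclidean norm); a graph is a diameter graph in $\mathbb{R}^d$ if it is isomorphic to one. $u_d(n,p)$ is the largest positive integer $k$ such that $\mathbb{P}_{n,p}\big(\exists W\subseteq V,\ |W|=k,\ G[W]$ is a diameter graph in $\mathbb{R}^d$ and $\chi(G[W])=d+1\big)>\frac12$, where $G[W]$ is the induced subgraph; if no such $k$ exists, $u_d(n,p)=0$. $u_d'(n,p)$ is defined identically with the additional requirement that $G[W]$ be connected. *)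

theory Defs
  imports "HOL-Analysis.Analysis"
begin

text \<open>Simple graphs on a vertex set of naturals, edges are 2-element sets.
  The random graph G(n,p) has vertex set V = {0..<n}.\<close>

definition all_edges :: "nat \<Rightarrow> nat set set" where
  "all_edges n = {e. \<exists>a b. a < n \<and> b < n \<and> a \<noteq> b \<and> e = {a, b}}"

text \<open>Probability under G(n,p) of a graph property P (a predicate on edge sets).\<close>
definition gnp_prob :: "nat \<Rightarrow> real \<Rightarrow> (nat set set \<Rightarrow> bool) \<Rightarrow> real" where
  "gnp_prob n p P = (\<Sum>E \<in> Pow (all_edges n).
      if P E then p ^ card E * (1 - p) ^ (card (all_edges n) - card E) else 0)"

text \<open>Edge set of the induced subgraph on W.\<close>
definition induced_edges :: "nat set set \<Rightarrow> nat set \<Rightarrow> nat set set" where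
  "induced_edges E W = {e \<in> E. e \<subseteq> W}"

text \<open>(W,E) is a diameter graph in the Euclidean space 'a (isomorphic to one).\<close>
definition diameter_graph_in :: "'a::euclidean_space itself \<Rightarrow> nat set \<Rightarrow> nat set set \<Rightarrow> bool" where
  "diameter_graph_in _ W E \<longleftrightarrow>
     E \<subseteq> {{x, y} | x y. x \<in> W \<and> y \<in> W \<and> x \<noteq> y} \<and>
     (\<exists>f :: nat \<Rightarrow> 'a. inj_on f W \<and>
        (\<forall>x\<in>W. \<forall>y\<in>W. x \<noteq> y \<longrightarrow>
           ({x, y} \<in> E \<longleftrightarrow> norm (f x - f y) = diameter (f ` W))))"

definition chromatic_number :: "nat set \<Rightarrow> nat set set \<Rightarrow> nat" where
  "chromatic_number W E = (LEAST k. \<exists>c :: nat \<Rightarrow> nat.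
      (\<forall>x\<in>W. c x < k) \<and> (\<forall>x\<in>W. \<forall>y\<in>W. {x, y} \<in> E \<longrightarrow> c x \<noteq> c y))"

definition graph_connected :: "nat set \<Rightarrow> nat set set \<Rightarrow> bool" where
  "graph_connected W E \<longleftrightarrow>
     (\<forall>x\<in>W. \<forall>y\<in>W. (x, y) \<in> ({(a, b). a \<in> W \<and> b \<in> W \<and> {a, b} \<in> E})\<^sup>*)"

text \<open>The event that G(n,p) (edge set E) contains an induced subgraph on k vertices
  which is a diameter graph in 'a with chromatic number DIM('a)+1
  (and, if conn, which is connected).\<close>
definition good_event :: "'a::euclidean_space itself \<Rightarrow> bool \<Rightarrow> nat \<Rightarrow> nat \<Rightarrow> nat set set \<Rightarrow> bool" where
  "good_event T conn n k E \<longleftrightarrow>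
     (\<exists>W. W \<subseteq> {..<n} \<and> card W = k \<and>
        diameter_graph_in T W (induced_edges E W) \<and>
        chromatic_number W (induced_edges E W) = DIM('a) + 1 \<and>
        (conn \<longrightarrow> graph_connected W (induced_edges E W)))"

definition u_gen :: "'a::euclidean_space itself \<Rightarrow> bool \<Rightarrow> nat \<Rightarrow> real \<Rightarrow> nat" where
  "u_gen T conn n p =
     (if \<exists>k>0. gnp_prob n p (good_event T conn n k) > 1/2
      then Max {k. k > 0 \<and> gnp_prob n p (good_event T conn n k) > 1/2}
      else 0)"

text \<open>u_d(n,p) and u'_d(n,p), the dimension d given as a Euclidean space type.\<close>
definition u_d :: "'a::euclidean_space itself \<Rightarrow> nat \<Rightarrow> real \<Rightarrow> nat" where
  "u_d T n p = u_gen T False n p"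

definition u_d' :: "'a::euclidean_space itself \<Rightarrow> nat \<Rightarrow> real \<Rightarrow> nat" where
  "u_d' T n p = u_gen T True n p"

end

theory Submission
  imports Defs
begin

text \<open>
  Consider a \<open>K\<^sub>4\<close> with \<open>m\<close> pendant vertices attached to one of its vertices \<open>v\<close>. It is connected, has
  chromatic number 4 and is a diameter graph in \<open>\<real>\<^sup>3\<close>: take a regular tetrahedron and put the pendant
  vertices on the sphere about \<open>v\<close> through the other three vertices, close to the centre of the
  spherical triangle that they span. So it suffices to find an induced copy with
  \<open>m = \<lfloor>(2 - \<epsilon>) log\<^bsub>1/q\<^esub> (np)\<rfloor>\<close>, which is done by the second moment method.

  Only copies are counted whose \<open>K\<^sub>4\<close> is one of \<open>M\<close> disjoint quadruples and whose pendant vertices form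
  a transversal of \<open>m\<close> disjoint blocks of \<open>L\<close> vertices. If two copies have \<open>l\<close> pendant vertices in
  common, then the joint probability exceeds the product by a factor of at most
  \<open>(p q\<^sup>3)\<^bsup>-l\<^esup> q\<^bsup>-l(l-1)/2\<^esup> \<le> y\<^bsup>l\<^esup>\<close> with \<open>y = q\<^bsup>-m/2\<^esup> / (p q\<^sup>3)\<close>, times \<open>p\<^bsup>-6\<^esup>\<close> if the \<open>K\<^sub>4\<close> is the same.
  Since transversals form a product space, averaging gives
  \<open>E X\<^sup>2 / (E X)\<^sup>2 \<le> (1 + y/L)\<^bsup>m\<^esup> (1 + 1/(p\<^sup>6 M))\<close>. With \<open>M\<close> of order \<open>n\<close> and \<open>L\<close> of order \<open>n/m\<close> this tends
  to 1, because \<open>q\<^bsup>-m/2\<^esup> \<le> (np)\<^bsup>1-\<epsilon>/2\<^esup>\<close> whereas \<open>m\<close>, \<open>1/p\<close> and \<open>1/q\<close> are \<open>n\<^bsup>o(1)\<^esup>\<close>.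
\<close>

section \<open>The second moment method in G(n,p)\<close>

lemma finite_all_edges: "finite (all_edges n)"
proof (rule finite_subset)
  show "all_edges n \<subseteq> Pow {..<n}" by (auto simp: all_edges_def)
qed simp

definition gnp_weight :: "nat \<Rightarrow> real \<Rightarrow> nat set set \<Rightarrow> real" where
  "gnp_weight n p E = p ^ card E * (1 - p) ^ (card (all_edges n) - card E)"

lemma gnp_weight_nonneg: "0 \<le> p \<Longrightarrow> p \<le> 1 \<Longrightarrow> 0 \<le> gnp_weight n p E"
  by (simp add: gnp_weight_def)

lemma gnp_prob_altdef:
  "gnp_prob n p P = (\<Sum>E\<in>Pow (all_edges n). gnp_weight n p E * of_bool (P E))"
  unfolding gnp_prob_def gnp_weight_def by (intro sum.cong) auto

lemma gnp_prob_mono: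
  assumes "0 \<le> p" "p \<le> 1" "\<And>E. E \<subseteq> all_edges n \<Longrightarrow> P E \<Longrightarrow> Q E"
  shows "gnp_prob n p P \<le> gnp_prob n p Q"
  unfolding gnp_prob_altdef using assms gnp_weight_nonneg[OF assms(1,2)]
  by (intro sum_mono mult_left_mono) auto

text \<open>The undecided pairs \<open>R\<close> contribute a factor 1: the sum over their subsets
  is the expansion of a product of factors p + (1 - p).\<close>

lemma gnp_prob_prescribed:
  assumes "A \<subseteq> all_edges n" "B \<subseteq> all_edges n" "A \<inter> B = {}"
  shows "gnp_prob n p (\<lambda>E. A \<subseteq> E \<and> B \<inter> E = {}) = p ^ card A * (1 - p) ^ card B"
proof -
  define R where "R = all_edges n - A - B"
  have fin: "finite A" "finite B" "finite R"
    using assms finite_all_edges[of n] by (auto simp: R_def intro: finite_subset)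
  have all: "all_edges n = A \<union> B \<union> R" using assms by (auto simp: R_def)
  have dis: "A \<inter> B = {}" "(A \<union> B) \<inter> R = {}" using assms by (auto simp: R_def)
  have card_all: "card (all_edges n) = card A + card B + card R"
    unfolding all using fin dis by (subst card_Un_disjoint; simp)+
  have "gnp_prob n p (\<lambda>E. A \<subseteq> E \<and> B \<inter> E = {})
      = (\<Sum>E\<in>{E\<in>Pow (all_edges n). A \<subseteq> E \<and> B \<inter> E = {}}. gnp_weight n p E)"
    unfolding gnp_prob_altdef
    by (rule sum.mono_neutral_cong_right) (auto simp: finite_all_edges)
  also have "\<dots> = (\<Sum>F\<in>Pow R. gnp_weight n p (A \<union> F))"
    by (rule sum.reindex_bij_witness[of _ "\<lambda>F. A \<union> F" "\<lambda>E. E - A"])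
      (use dis all in \<open>auto simp: Un_absorb1\<close>)
  also have "\<dots> = (\<Sum>F\<in>Pow R. p ^ card A * (1 - p) ^ card B * (p ^ card F * (1 - p) ^ card (R - F)))"
  proof (rule sum.cong)
    fix F assume F: "F \<in> Pow R"
    have finF: "finite F" using F fin by (auto intro: finite_subset)
    have "card (A \<union> F) = card A + card F"
      using F dis fin finF by (intro card_Un_disjoint) auto
    moreover have "card (R - F) = card R - card F" "card F \<le> card R"
      using F fin finF by (auto simp: card_Diff_subset card_mono)
    ultimately show "gnp_weight n p (A \<union> F)
        = p ^ card A * (1 - p) ^ card B * (p ^ card F * (1 - p) ^ card (R - F))"
      by (simp add: gnp_weight_def card_all power_add flip: add_diff_assoc)
  qed simp
  also have "\<dots> = p ^ card A * (1 - p) ^ card B"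
    using prod_add[OF fin(3), of "\<lambda>_. p" "\<lambda>_. 1 - p"] by (simp add: sum_distrib_left[symmetric])
  finally show ?thesis .
qed

text \<open>Lets two prescriptions be merged without a check that they are compatible: contradictory
  ones have probability 0.\<close>

lemma gnp_prob_prescribed_le:
  assumes "A \<subseteq> all_edges n" "B \<subseteq> all_edges n" "0 \<le> p" "p \<le> 1"
  shows "gnp_prob n p (\<lambda>E. A \<subseteq> E \<and> B \<inter> E = {}) \<le> p ^ card A * (1 - p) ^ card B"
proof (cases "A \<inter> B = {}")
  case False
  then have "gnp_prob n p (\<lambda>E. A \<subseteq> E \<and> B \<inter> E = {}) = 0"
    unfolding gnp_prob_altdef by (intro sum.neutral) auto
  then show ?thesis using assms by simp
qed (use assms gnp_prob_prescribed in simp)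

text \<open>Let X count the t whose prescription holds. Cauchy-Schwarz gives (E X)^2 \<le> P(X > 0)
  E X^2, and \<open>corr\<close>, summed over t, yields E X^2 < 2 (E X)^2. Its summands bound P(t
  and s) / (P(t) P(s)), since an edge or non-edge common to t and s is paid for once instead of
  twice.\<close>

lemma gnp_prob_exists_gt_half:
  fixes A B :: "'t \<Rightarrow> nat set set"
  assumes p: "0 < p" "p < 1" and T: "finite T" "T \<noteq> {}"
    and sub: "\<And>t. t \<in> T \<Longrightarrow> A t \<subseteq> all_edges n" "\<And>t. t \<in> T \<Longrightarrow> B t \<subseteq> all_edges n"
    and dis: "\<And>t. t \<in> T \<Longrightarrow> A t \<inter> B t = {}"
    and card: "\<And>t. t \<in> T \<Longrightarrow> card (A t) = a" "\<And>t. t \<in> T \<Longrightarrow> card (B t) = b"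
    and corr: "\<And>t. t \<in> T \<Longrightarrow>
      (\<Sum>s\<in>T. (1/p) ^ card (A t \<inter> A s) * (1/(1-p)) ^ card (B t \<inter> B s)) < 2 * card T"
  shows "gnp_prob n p (\<lambda>E. \<exists>t\<in>T. A t \<subseteq> E \<and> B t \<inter> E = {}) > 1/2"
proof -
  define I where "I t E = (of_bool (A t \<subseteq> E \<and> B t \<inter> E = {}) :: real)" for t E
  define X where "X E = (\<Sum>t\<in>T. I t E)" for E
  define w where "w = gnp_weight n p"
  define U where "U = Pow (all_edges n)"
  define Y where "Y E = (of_bool (\<exists>t\<in>T. A t \<subseteq> E \<and> B t \<inter> E = {}) :: real)" for E
  define c where "c = p ^ a * (1 - p) ^ b"
  have c: "c > 0" using p by (simp add: c_def)
  have w: "w E \<ge> 0" for E using p by (simp add: w_def gnp_weight_nonneg)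
  have mean: "(\<Sum>E\<in>U. w E * I t E) = c" if "t \<in> T" for t
    using gnp_prob_prescribed[OF sub[OF that] dis[OF that], of p] card[OF that]
    by (simp add: gnp_prob_altdef U_def w_def I_def c_def)
  have EX: "(\<Sum>E\<in>U. w E * X E) = card T * c"
  proof -
    have "(\<Sum>E\<in>U. w E * X E) = (\<Sum>t\<in>T. \<Sum>E\<in>U. w E * I t E)"
      unfolding X_def sum_distrib_left by (rule sum.swap)
    then show ?thesis by (simp add: mean)
  qed
  have pair: "(\<Sum>E\<in>U. w E * (I t E * I s E))
      \<le> c\<^sup>2 * ((1/p) ^ card (A t \<inter> A s) * (1/(1-p)) ^ card (B t \<inter> B s))"
    if t: "t \<in> T" and s: "s \<in> T" for t s
  proof -
    have fin: "finite (A t)" "finite (A s)" "finite (B t)" "finite (B s)"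
      using sub[OF t] sub[OF s] finite_all_edges[of n] by (blast intro: finite_subset)+
    have cards: "card (A t \<union> A s) + card (A t \<inter> A s) = 2 * a"
        "card (B t \<union> B s) + card (B t \<inter> B s) = 2 * b"
      using card_Un_Int[OF fin(1,2)] card_Un_Int[OF fin(3,4)] card t s by auto
    have pow: "x ^ card S = (x ^ d)\<^sup>2 * (1/x) ^ card S'"
      if "x > 0" "card S + card S' = 2 * d" for x :: real and S S' :: "nat set set" and d
    proof -
      have "(x ^ d)\<^sup>2 = x ^ card S * x ^ card S'"
        using that(2) by (metis mult.commute power_add power_mult)
      then show ?thesis using that(1) by (simp add: power_one_over)
    qed
    have "(\<Sum>E\<in>U. w E * (I t E * I s E))
        = gnp_prob n p (\<lambda>E. A t \<union> A s \<subseteq> E \<and> (B t \<union> B s) \<inter> E = {})"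
      unfolding gnp_prob_altdef U_def w_def I_def
      by (intro sum.cong refl arg_cong2[where f="(*)"]) (auto simp: of_bool_def)
    also have "\<dots> \<le> p ^ card (A t \<union> A s) * (1 - p) ^ card (B t \<union> B s)"
      by (rule gnp_prob_prescribed_le) (use sub t s p in auto)
    also have "\<dots> = c\<^sup>2 * ((1/p) ^ card (A t \<inter> A s) * (1/(1-p)) ^ card (B t \<inter> B s))"
      using pow[OF p(1) cards(1)] pow[OF _ cards(2), of "1 - p"] p
      by (simp add: c_def power_mult_distrib)
    finally show ?thesis .
  qed
  have EX2: "(\<Sum>E\<in>U. w E * (X E)\<^sup>2) < 2 * (card T * c)\<^sup>2"
  proof -
    have "(\<Sum>E\<in>U. w E * (X E)\<^sup>2) = (\<Sum>E\<in>U. \<Sum>t\<in>T. \<Sum>s\<in>T. w E * (I t E * I s E))"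
      unfolding X_def power2_eq_square sum_product by (simp add: sum_distrib_left)
    also have "\<dots> = (\<Sum>t\<in>T. \<Sum>E\<in>U. \<Sum>s\<in>T. w E * (I t E * I s E))"
      by (rule sum.swap)
    also have "\<dots> = (\<Sum>t\<in>T. \<Sum>s\<in>T. \<Sum>E\<in>U. w E * (I t E * I s E))"
      by (intro sum.cong refl sum.swap)
    also have "\<dots> \<le> (\<Sum>t\<in>T. \<Sum>s\<in>T. c\<^sup>2 * ((1/p) ^ card (A t \<inter> A s) * (1/(1-p)) ^ card (B t \<inter> B s)))"
      by (intro sum_mono pair)
    also have "\<dots> = (\<Sum>t\<in>T. c\<^sup>2 * (\<Sum>s\<in>T. (1/p) ^ card (A t \<inter> A s) * (1/(1-p)) ^ card (B t \<inter> B s)))"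
      by (simp add: sum_distrib_left)
    also have "\<dots> < (\<Sum>t\<in>T. c\<^sup>2 * (2 * card T))"
      using T c by (intro sum_strict_mono mult_strict_left_mono corr) auto
    also have "\<dots> = 2 * (card T * c)\<^sup>2"
      by (simp add: power2_eq_square)
    finally show ?thesis .
  qed
  \<comment> \<open>The weight is split into two square roots to fit the unweighted Cauchy-Schwarz
    inequality; \<open>Y\<close> may be inserted because \<open>X\<close> vanishes wherever
    \<open>Y\<close> does.\<close>
  have "(card T * c)\<^sup>2 = (\<Sum>E\<in>U. (sqrt (w E) * Y E) * (sqrt (w E) * X E))\<^sup>2"
  proof -
    have XY: "w E * X E = (sqrt (w E) * Y E) * (sqrt (w E) * X E)" for E
    proof (cases "\<exists>t\<in>T. A t \<subseteq> E \<and> B t \<inter> E = {}")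
      case True
      then show ?thesis using w[of E] by (simp add: Y_def)
    next
      case False
      then have "X E = 0" unfolding X_def I_def by (intro sum.neutral) auto
      then show ?thesis by simp
    qed
    show ?thesis
      unfolding EX[symmetric] by (intro arg_cong[where f="\<lambda>x. x\<^sup>2"] sum.cong refl XY)
  qed
  also have "\<dots> \<le> (\<Sum>E\<in>U. (sqrt (w E) * Y E)\<^sup>2) * (\<Sum>E\<in>U. (sqrt (w E) * X E)\<^sup>2)"
    by (rule Cauchy_Schwarz_ineq_sum)
  also have "\<dots> = (\<Sum>E\<in>U. w E * Y E) * (\<Sum>E\<in>U. w E * (X E)\<^sup>2)"
  proof -
    have "(Y E)\<^sup>2 = Y E" for E by (simp add: Y_def)
    then show ?thesis using w by (simp add: power_mult_distrib)
  qed
  finally have CS: "(card T * c)\<^sup>2 \<le> (\<Sum>E\<in>U. w E * Y E) * (\<Sum>E\<in>U. w E * (X E)\<^sup>2)" .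
  have "(\<Sum>E\<in>U. w E * Y E) > 1/2"
  proof (rule ccontr)
    assume "\<not> ?thesis"
    then have "(\<Sum>E\<in>U. w E * Y E) * (\<Sum>E\<in>U. w E * (X E)\<^sup>2) \<le> 1/2 * (\<Sum>E\<in>U. w E * (X E)\<^sup>2)"
      using w by (intro mult_right_mono sum_nonneg) auto
    then show False using CS EX2 by linarith
  qed
  then show ?thesis by (simp add: gnp_prob_altdef U_def w_def Y_def)
qed

section \<open>A diameter graph in three dimensions\<close>

text \<open>A \<open>K\<^sub>4\<close> on the vertices 0, 1, 2, 3, with the vertices \<open>4, \<dots>, m + 3\<close> pendant at 0.\<close>
definition K4_star :: "nat \<Rightarrow> nat set set" where
  "K4_star m = {{x, y} | x y. x < y \<and> y < m + 4 \<and> (x = 0 \<or> y < 4)}"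

lemma K4_star_iff:
  assumes "x < y" "y < m + 4"
  shows "{x, y} \<in> K4_star m \<longleftrightarrow> x = 0 \<or> y < 4"
  using assms unfolding K4_star_def by (auto simp: doubleton_eq_iff)

text \<open>Vertices 0 to 3 form a regular tetrahedron of edge length \<open>\<surd>2\<close>. The others lie on the sphere
  of radius \<open>\<surd>2\<close> about the origin near \<open>\<surd>(2/3) (1, 1, 1)\<close>, where all coordinates are at least 7/10;
  two points of that sphere are closer than \<open>\<surd>2\<close> iff their inner product exceeds 1.\<close>
definition K4_star_point :: "nat \<Rightarrow> real^3" where
  "K4_star_point n = (if n = 0 then vector [0, 0, 0] else if n = 1 then vector [1, 1, 0]
     else if n = 2 then vector [1, 0, 1] else if n = 3 then vector [0, 1, 1]
     else vector [sqrt (2/3 + 1 / (real n + 20)), sqrt (2/3 - 1 / (real n + 20)), sqrt (2/3)])"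

lemma K4_star_point_simps [simp]:
  "K4_star_point 0 = vector [0, 0, 0]" "K4_star_point (Suc 0) = vector [1, 1, 0]"
  "K4_star_point 2 = vector [1, 0, 1]" "K4_star_point 3 = vector [0, 1, 1]"
  by (simp_all add: K4_star_point_def)

section \<open>Distances in the point configuration\<close>

lemma norm_diff_vector_3:
  fixes a b c :: real
  shows "norm (vector [a, b, c] - vector [a', b', c'] :: real^3)
    = sqrt ((a - a')\<^sup>2 + (b - b')\<^sup>2 + (c - c')\<^sup>2)"
  by (simp add: norm_eq_sqrt_inner inner_vec_def sum_3 power2_eq_square)

lemma K4_star_point_bounds:
  assumes "n \<ge> 4"
  obtains a b c where "K4_star_point n = vector [a, b, c]"
    "a \<ge> 7/10" "b \<ge> 7/10" "c \<ge> 7/10" "a\<^sup>2 + b\<^sup>2 + c\<^sup>2 = 2" "a\<^sup>2 = 2/3 + 1 / (real n + 20)"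
proof -
  \<comment> \<open>The offset 20 keeps the perturbation below 1/20, so every radicand is at least
    2/3 - 1/20 > 1/2 > (7/10)^2.\<close>
  have t: "0 \<le> 1 / (real n + 20)" "1 / (real n + 20) \<le> 1/20"
    by (auto simp: field_simps)
  have ge: "sqrt x \<ge> 7/10" if "x \<ge> 1/2" for x
    using that by (intro real_le_rsqrt) (simp add: power2_eq_square)
  show thesis
  proof (rule that[of "sqrt (2/3 + 1 / (real n + 20))" "sqrt (2/3 - 1 / (real n + 20))" "sqrt (2/3)"])
    show "(sqrt (2/3 + 1 / (real n + 20)))\<^sup>2 + (sqrt (2/3 - 1 / (real n + 20)))\<^sup>2 + (sqrt (2/3))\<^sup>2 = 2"
      using real_sqrt_pow2[of "2/3 + 1 / (real n + 20)"] real_sqrt_pow2[of "2/3 - 1 / (real n + 20)"]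
        real_sqrt_pow2[of "2/3"] t by linarith
    show "7/10 \<le> sqrt (2/3 + 1 / (real n + 20))" "7/10 \<le> sqrt (2/3 - 1 / (real n + 20))"
      "7/10 \<le> sqrt (2/3)"
      by (rule ge, use t in linarith)+
  qed (use assms in \<open>simp_all add: K4_star_point_def\<close>)
qed

text \<open>Two pendant points have inner product at least 3 (7/10)^2 > 1. A pendant point and one
  of the tetrahedron vertices 1, 2, 3 have the sum of two coordinates as inner product, at least
  14/10. Pendant points differ from each other in the first coordinate, and from 1, 2, 3 where those
  have a zero coordinate.\<close>

lemma K4_star_point_dist_pendant:
  assumes "4 \<le> y"
  shows "norm (K4_star_point 0 - K4_star_point y) = sqrt 2"
    and "0 < x \<Longrightarrow> x < y \<Longrightarrow> norm (K4_star_point x - K4_star_point y) < sqrt 2"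
    and "x < y \<Longrightarrow> K4_star_point x \<noteq> K4_star_point y"
proof -
  obtain a b c where abc: "K4_star_point y = vector [a, b, c]"
    "a \<ge> 7/10" "b \<ge> 7/10" "c \<ge> 7/10" "a\<^sup>2 + b\<^sup>2 + c\<^sup>2 = 2" "a\<^sup>2 = 2/3 + 1 / (real y + 20)"
    using K4_star_point_bounds[OF assms] .
  show *: "norm (K4_star_point 0 - K4_star_point y) = sqrt 2"
    using abc by (simp add: norm_diff_vector_3)
  have close: "norm (vector [a', b', c'] - vector [a, b, c] :: real^3) < sqrt 2"
    if "a'\<^sup>2 + b'\<^sup>2 + c'\<^sup>2 = 2" "a' * a + b' * b + c' * c > 1" for a' b' c'
  proof -
    have "(a' - a)\<^sup>2 + (b' - b)\<^sup>2 + (c' - c)\<^sup>2 =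
      (a'\<^sup>2 + b'\<^sup>2 + c'\<^sup>2) + (a\<^sup>2 + b\<^sup>2 + c\<^sup>2) - 2 * (a' * a + b' * b + c' * c)"
      by (simp add: power2_eq_square algebra_simps)
    then show ?thesis using that abc unfolding norm_diff_vector_3 by simp
  qed
  show lt: "norm (K4_star_point x - K4_star_point y) < sqrt 2" if x: "0 < x" "x < y"
  proof -
    consider "x = 1" | "x = 2" | "x = 3" | "x \<ge> 4" using x by linarith
    then show ?thesis
    proof cases
      case 4
      obtain a' b' c' where abc': "K4_star_point x = vector [a', b', c']"
        "a' \<ge> 7/10" "b' \<ge> 7/10" "c' \<ge> 7/10" "a'\<^sup>2 + b'\<^sup>2 + c'\<^sup>2 = 2"
        using K4_star_point_bounds[OF 4] by metis
      have "7/10 * (7/10) \<le> a' * a" "7/10 * (7/10) \<le> b' * b" "7/10 * (7/10) \<le> c' * c"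
        by (rule mult_mono; use abc abc' in linarith)+
      then have "a' * a + b' * b + c' * c > 1" by simp
      then show ?thesis using close abc abc' by simp
    qed (use abc close[of 1 1 0] close[of 1 0 1] close[of 0 1 1] in auto)
  qed
  show "K4_star_point x \<noteq> K4_star_point y" if "x < y"
  proof (cases "x < 4")
    case True
    then consider "x = 0" | "x = 1" | "x = 2" | "x = 3" by linarith
    then show ?thesis
    proof cases
      case 1
      then show ?thesis using * by auto
    qed (use abc in \<open>auto simp: vec_eq_iff forall_3\<close>)
  next
    case False
    then obtain a' b' c' where abc': "K4_star_point x = vector [a', b', c']" "a'\<^sup>2 = 2/3 + 1 / (real x + 20)"
      using K4_star_point_bounds[of x] by (metis not_less)
    have "1 / (real x + 20) \<noteq> 1 / (real y + 20)" using that by (simp add: field_simps)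
    then have "a'\<^sup>2 \<noteq> a\<^sup>2" using abc abc' by simp
    then show ?thesis using abc abc' by (auto simp: vec_eq_iff forall_3)
  qed
qed

lemma K4_star_point_dist_K4:
  assumes "x < y" "y < 4"
  shows "norm (K4_star_point x - K4_star_point y) = sqrt 2"
proof -
  from assms have "(x, y) \<in> {(0,1), (0,2), (0,3), (1,2), (1,3), (2,3)}" by auto
  then show ?thesis
    by (auto simp: norm_diff_vector_3)
qed

lemma K4_star_point_dist:
  assumes "x < y" "y < m + 4"
  shows "norm (K4_star_point x - K4_star_point y) \<le> sqrt 2"
    and "norm (K4_star_point x - K4_star_point y) = sqrt 2 \<longleftrightarrow> {x, y} \<in> K4_star m"
    and "K4_star_point x \<noteq> K4_star_point y"
proof -
  consider "y < 4" | "y \<ge> 4" "x = 0" | "y \<ge> 4" "x > 0" by linarith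
  then have "norm (K4_star_point x - K4_star_point y) \<le> sqrt 2
      \<and> (norm (K4_star_point x - K4_star_point y) = sqrt 2 \<longleftrightarrow> {x, y} \<in> K4_star m)
      \<and> K4_star_point x \<noteq> K4_star_point y"
  proof cases
    case 1
    then have "norm (K4_star_point x - K4_star_point y) = sqrt 2"
      using assms K4_star_point_dist_K4 by simp
    moreover from this have "K4_star_point x \<noteq> K4_star_point y" by auto
    ultimately show ?thesis using 1 assms by (simp add: K4_star_iff)
  next
    case 2
    then show ?thesis using assms K4_star_point_dist_pendant(1)[of y] K4_star_point_dist_pendant(2,3)[of y x] by (auto simp: K4_star_iff)
  next
    case 3
    then show ?thesis using assms K4_star_point_dist_pendant(1)[of y] K4_star_point_dist_pendant(2,3)[of y x] by (auto simp: K4_star_iff)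
  qed
  then show "norm (K4_star_point x - K4_star_point y) \<le> sqrt 2"
    "norm (K4_star_point x - K4_star_point y) = sqrt 2 \<longleftrightarrow> {x, y} \<in> K4_star m"
    "K4_star_point x \<noteq> K4_star_point y" by auto
qed

lemma K4_star_point_dist':
  assumes "x < m + 4" "y < m + 4" "x \<noteq> y"
  shows "norm (K4_star_point x - K4_star_point y) \<le> sqrt 2"
    and "norm (K4_star_point x - K4_star_point y) = sqrt 2 \<longleftrightarrow> {x, y} \<in> K4_star m"
    and "K4_star_point x \<noteq> K4_star_point y"
  using assms K4_star_point_dist[of x y m] K4_star_point_dist[of y x m]
  by (cases "x < y"; force simp: norm_minus_commute insert_commute)+

lemma inj_on_K4_star_point: "inj_on K4_star_point {..<m + 4}"
  using K4_star_point_dist'(3) by (auto simp: inj_on_def)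

lemma diameter_K4_star_point: "diameter (K4_star_point ` {..<m + 4}) = sqrt 2"
proof (rule antisym)
  show "diameter (K4_star_point ` {..<m + 4}) \<le> sqrt 2"
  proof (rule diameter_le)
    fix u v assume "u \<in> K4_star_point ` {..<m + 4}" "v \<in> K4_star_point ` {..<m + 4}"
    then obtain x y where "u = K4_star_point x" "v = K4_star_point y" "x < m + 4" "y < m + 4" by auto
    then show "norm (u - v) \<le> sqrt 2" using K4_star_point_dist'(1)[of x m y] by (cases "x = y") auto
  qed simp
  have "dist (K4_star_point 0) (K4_star_point 1) \<le> diameter (K4_star_point ` {..<m + 4})"
    by (intro diameter_bounded_bound imageI finite_imp_bounded) auto
  then show "sqrt 2 \<le> diameter (K4_star_point ` {..<m + 4})"
    using K4_star_point_dist_K4[of 0 1] by (simp add: dist_norm)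
qed

text \<open>The inverse \<open>h\<close> of the embedding pulls the point configuration and a
  colouring of the pattern back to the copy. The \<open>K4\<close> forces four colours.\<close>

lemma K4_star_copy_good:
  assumes g: "inj_on g {..<m + 4}"
    and F: "F = image g ` K4_star m"
  shows "diameter_graph_in TYPE(real^3) (g ` {..<m + 4}) F"
    and "chromatic_number (g ` {..<m + 4}) F = 4"
    and "graph_connected (g ` {..<m + 4}) F"
proof -
  define h where "h = inv_into {..<m + 4} g"
  have h: "h (g x) = x" if "x < m + 4" for x
    using g that by (simp add: h_def inv_into_f_f)
  have sub: "K4_star m \<subseteq> Pow {..<m + 4}" by (auto simp: K4_star_def)
  have adj: "{g x, g y} \<in> F \<longleftrightarrow> {x, y} \<in> K4_star m" if "x < m + 4" "y < m + 4" for x y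
  proof
    assume "{g x, g y} \<in> F"
    then obtain e where e: "e \<in> K4_star m" "g ` {x, y} = g ` e" by (auto simp: F)
    then have "{x, y} = e" using inj_on_image_eq_iff[OF g, of "{x, y}" e] sub that by auto
    then show "{x, y} \<in> K4_star m" using e by simp
  next
    assume "{x, y} \<in> K4_star m"
    then have "g ` {x, y} \<in> F" unfolding F by (rule imageI)
    then show "{g x, g y} \<in> F" by simp
  qed
  show "diameter_graph_in TYPE(real^3) (g ` {..<m + 4}) F"
    unfolding diameter_graph_in_def
  proof (intro conjI exI[of _ "K4_star_point \<circ> h"] ballI impI)
    show "F \<subseteq> {{x, y} |x y. x \<in> g ` {..<m + 4} \<and> y \<in> g ` {..<m + 4} \<and> x \<noteq> y}"
    proof
      fix e assume "e \<in> F"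
      then obtain x y where xy: "e = g ` {x, y}" "x < y" "y < m + 4" unfolding F K4_star_def by auto
      then have "g x \<noteq> g y" using g by (auto simp: inj_on_def)
      then show "e \<in> {{x, y} |x y. x \<in> g ` {..<m + 4} \<and> y \<in> g ` {..<m + 4} \<and> x \<noteq> y}"
        using xy by (intro CollectI exI[of _ "g x"] exI[of _ "g y"]) auto
    qed
    show "inj_on (K4_star_point \<circ> h) (g ` {..<m + 4})"
      using inj_on_K4_star_point[of m] h by (auto simp: inj_on_def)
    fix u v assume uv: "u \<in> g ` {..<m + 4}" "v \<in> g ` {..<m + 4}" "u \<noteq> v"
    then obtain x y where xy: "u = g x" "v = g y" "x < m + 4" "y < m + 4" "x \<noteq> y" by auto
    have "(K4_star_point \<circ> h) ` g ` {..<m + 4} = K4_star_point ` {..<m + 4}"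
      using h by (force simp: image_iff)
    then show "({u, v} \<in> F) = (norm ((K4_star_point \<circ> h) u - (K4_star_point \<circ> h) v) =
           diameter ((K4_star_point \<circ> h) ` g ` {..<m + 4}))"
      using xy h adj K4_star_point_dist'(2)[of x m y] by (simp add: diameter_K4_star_point)
  qed
  show "chromatic_number (g ` {..<m + 4}) F = 4"
    unfolding chromatic_number_def
  proof (rule Least_equality)
    \<comment> \<open>Pendant vertices have 0 as their only neighbour, so any colour other than 0
      suits them.\<close>
    define c where "c = (\<lambda>u. if u < 4 then u else (1::nat))"
    have c4: "c x < 4" for x by (simp add: c_def)
    have col: "c x \<noteq> c y" if "{x, y} \<in> K4_star m" for x y
      using that by (auto simp: K4_star_def c_def doubleton_eq_iff)
    show "\<exists>c. (\<forall>x\<in>g ` {..<m + 4}. c x < (4::nat)) \<and>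
        (\<forall>x\<in>g ` {..<m + 4}. \<forall>y\<in>g ` {..<m + 4}. {x, y} \<in> F \<longrightarrow> c x \<noteq> c y)"
      using h adj col c4 by (intro exI[of _ "c \<circ> h"]) auto
  next
    fix k :: nat
    assume "\<exists>c. (\<forall>x\<in>g ` {..<m + 4}. c x < k) \<and>
        (\<forall>x\<in>g ` {..<m + 4}. \<forall>y\<in>g ` {..<m + 4}. {x, y} \<in> F \<longrightarrow> c x \<noteq> c y)"
    then obtain c where c: "\<And>x. x < m + 4 \<Longrightarrow> c (g x) < k"
      "\<And>x y. x < m + 4 \<Longrightarrow> y < m + 4 \<Longrightarrow> {g x, g y} \<in> F \<Longrightarrow> c (g x) \<noteq> c (g y)" by auto
    have "inj_on (c \<circ> g) {..<4}"
    proof (rule linorder_inj_onI)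
      fix x y :: nat assume "x < y" "x \<in> {..<4}" "y \<in> {..<4}"
      then show "(c \<circ> g) x \<noteq> (c \<circ> g) y" using c(2)[of x y] adj[of x y] by (auto simp: K4_star_iff)
    qed auto
    then have "card {..<4::nat} \<le> card {..<k}"
      by (rule card_inj_on_le) (use c(1) in auto)
    then show "4 \<le> k" by simp
  qed
  show "graph_connected (g ` {..<m + 4}) F"
    unfolding graph_connected_def
  proof (intro ballI)
    let ?R = "{(a, b). a \<in> g ` {..<m + 4} \<and> b \<in> g ` {..<m + 4} \<and> {a, b} \<in> F}"
    \<comment> \<open>Vertex 0 is adjacent to all others, so any two vertices are linked through
      \<open>g 0\<close>.\<close>
    have *: "(g 0, g x) \<in> ?R\<^sup>*" "(g x, g 0) \<in> ?R\<^sup>*" if "x < m + 4" for x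
    proof -
      have "(g 0, g x) \<in> ?R \<and> (g x, g 0) \<in> ?R" if "x > 0"
        using adj[of 0 x] \<open>x < m + 4\<close> that by (auto simp: K4_star_iff insert_commute)
      then have "(g 0, g x) \<in> ?R\<^sup>* \<and> (g x, g 0) \<in> ?R\<^sup>*"
        by (cases "x = 0") (auto simp del: mem_Collect_eq case_prod_conv)
      then show "(g 0, g x) \<in> ?R\<^sup>*" "(g x, g 0) \<in> ?R\<^sup>*" by auto
    qed
    fix u v assume "u \<in> g ` {..<m + 4}" "v \<in> g ` {..<m + 4}"
    then show "(u, v) \<in> ?R\<^sup>*" using * by (blast intro: rtrancl_trans)
  qed
qed

section \<open>Correlations between block embeddings\<close>

definition K4_star_compl :: "nat \<Rightarrow> nat set set" where
  "K4_star_compl m = all_edges (m + 4) - K4_star m"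

lemma K4_star_subset: "K4_star m \<subseteq> all_edges (m + 4)"
proof
  fix e assume "e \<in> K4_star m"
  then obtain x y where "e = {x, y}" "x < y" "y < m + 4" by (auto simp: K4_star_def)
  then show "e \<in> all_edges (m + 4)"
    unfolding all_edges_def by (intro CollectI exI[of _ x] exI[of _ y]) simp
qed

text \<open>A pair \<open>(i, \<phi>)\<close> embeds the pattern with its \<open>K\<^sub>4\<close> on the \<open>i\<close>-th of \<open>M\<close> consecutive quadruples and its
  pendant vertices \<open>u\<close> at position \<open>\<phi> u\<close> of the \<open>(u - 4)\<close>-th of \<open>m\<close> blocks of length \<open>L\<close> behind them.\<close>
definition block_emb :: "nat \<Rightarrow> nat \<Rightarrow> nat \<times> (nat \<Rightarrow> nat) \<Rightarrow> nat \<Rightarrow> nat" where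
  "block_emb M L t u = (if u < 4 then 4 * fst t + u else 4 * M + (u - 4) * L + snd t u)"

definition block_index :: "nat \<Rightarrow> nat \<Rightarrow> nat \<Rightarrow> (nat \<times> (nat \<Rightarrow> nat)) set" where
  "block_index m M L = {..<M} \<times> ({4..<m + 4} \<rightarrow>\<^sub>E {..<L})"

text \<open>Recovers the pattern vertex from its image, independently of the embedding. Hence two
  embeddings can only share the edges on which they coincide pointwise.\<close>
definition block_type :: "nat \<Rightarrow> nat \<Rightarrow> nat \<Rightarrow> nat" where
  "block_type M L v = (if v < 4 * M then v mod 4 else 4 + (v - 4 * M) div L)"

lemma block_type_emb:
  assumes "t \<in> block_index m M L" "u < m + 4"
  shows "block_type M L (block_emb M L t u) = u"
proof (cases "u < 4")
  case True
  then show ?thesis using assms by (auto simp: block_type_def block_emb_def block_index_def)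
next
  case False
  then have "snd t u < L" using assms by (auto simp: block_index_def PiE_iff)
  then show ?thesis using False by (simp add: block_type_def block_emb_def)
qed

lemma block_emb_less:
  assumes "t \<in> block_index m M L" "u < m + 4" "4 * M + m * L \<le> n"
  shows "block_emb M L t u < n"
proof (cases "u < 4")
  case True
  then show ?thesis using assms by (auto simp: block_emb_def block_index_def)
next
  case False
  then have "snd t u < L" using assms by (auto simp: block_index_def PiE_iff)
  then have "(u - 4) * L + snd t u < Suc (u - 4) * L" by simp
  also have "\<dots> \<le> m * L" using assms False by (intro mult_right_mono) auto
  finally show ?thesis using False assms by (simp add: block_emb_def)
qed

lemma inj_on_block_emb:
  assumes "t \<in> block_index m M L"
  shows "inj_on (block_emb M L t) {..<m + 4}"
  by (rule inj_on_inverseI[where g="block_type M L"]) (use block_type_emb[OF assms] in simp)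

section \<open>Edges and non-edges shared by two block embeddings\<close>

lemma all_edges_image:
  assumes "inj_on g {..<k}" "\<And>u. u < k \<Longrightarrow> g u < n"
  shows "image g ` all_edges k \<subseteq> all_edges n"
proof
  fix e assume "e \<in> image g ` all_edges k"
  then obtain a b where "a < k" "b < k" "a \<noteq> b" "e = {g a, g b}" by (auto simp: all_edges_def)
  then show "e \<in> all_edges n"
    using assms unfolding all_edges_def inj_on_def by blast
qed

lemma inj_on_image_edges:
  assumes "inj_on g {..<k}"
  shows "inj_on (image g) (all_edges k)"
  by (rule inj_on_subset[OF inj_on_image_Pow[OF assms]]) (auto simp: all_edges_def)

text \<open>By \<open>block_type\<close>, a vertex common to both images comes from the same pattern
  vertex under both embeddings. Counting shared pairs is thereby reduced to counting inside the
  pattern.\<close>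

lemma block_emb_common_edges:
  assumes t: "t \<in> block_index m M L" and s: "s \<in> block_index m M L"
    and H: "H \<subseteq> all_edges (m + 4)"
  shows "card (image (block_emb M L t) ` H \<inter> image (block_emb M L s) ` H)
    \<le> card {e \<in> H. e \<subseteq> {u. block_emb M L t u = block_emb M L s u}}"
proof -
  have sub: "e \<subseteq> {..<m + 4}" if "e \<in> H" for e using that H by (auto simp: all_edges_def)
  have "image (block_emb M L t) ` H \<inter> image (block_emb M L s) ` H
      \<subseteq> image (block_emb M L t) ` {e \<in> H. e \<subseteq> {u. block_emb M L t u = block_emb M L s u}}"
  proof
    fix x assume "x \<in> image (block_emb M L t) ` H \<inter> image (block_emb M L s) ` H"
    then have "x \<in> image (block_emb M L t) ` H" "x \<in> image (block_emb M L s) ` H" by simp_all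
    then obtain e e' where e: "e \<in> H" "e' \<in> H"
      and x: "x = block_emb M L t ` e" "x = block_emb M L s ` e'" by (elim imageE)
    have "block_emb M L t u = block_emb M L s u" if "u \<in> e" for u
    proof -
      have "block_emb M L t u \<in> x" unfolding x(1) using that by (rule imageI)
      then obtain v where v: "v \<in> e'" "block_emb M L t u = block_emb M L s v"
        unfolding x(2) by (elim imageE)
      have "u < m + 4" "v < m + 4" using sub[OF e(1)] sub[OF e(2)] that v(1) by auto
      then have "u = v" using block_type_emb[OF t, of u] block_type_emb[OF s, of v] v(2) by simp
      then show ?thesis using v by simp
    qed
    then show "x \<in> image (block_emb M L t) ` {e \<in> H. e \<subseteq> {u. block_emb M L t u = block_emb M L s u}}"
      unfolding x(1) using e(1) by (intro imageI) blast
  qed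
  moreover have fin: "finite {e \<in> H. e \<subseteq> {u. block_emb M L t u = block_emb M L s u}}"
    using finite_subset[OF H finite_all_edges] by simp
  ultimately show ?thesis
    by (intro le_trans[OF card_mono[OF finite_imageI[OF fin]] card_image_le[OF fin]])
qed

definition agreement :: "nat \<Rightarrow> (nat \<Rightarrow> nat) \<Rightarrow> (nat \<Rightarrow> nat) \<Rightarrow> nat set" where
  "agreement m \<phi> \<psi> = {u \<in> {4..<m + 4}. \<phi> u = \<psi> u}"

lemma finite_agreement [simp]: "finite (agreement m \<phi> \<psi>)"
  by (simp add: agreement_def)

text \<open>The quadruples are disjoint, so on the \<open>K4\<close> two embeddings coincide
  everywhere or nowhere; only pendant positions can agree individually.\<close>

lemma block_emb_eq_iff:
  assumes "u < m + 4"
  shows "block_emb M L (i, \<phi>) u = block_emb M L (j, \<psi>) u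
    \<longleftrightarrow> u \<in> agreement m \<phi> \<psi> \<or> (i = j \<and> u < 4)"
  using assms by (auto simp: block_emb_def agreement_def)

text \<open>Every pattern edge has an end in the \<open>K4\<close>, so different quadruples leave
  nothing to share. Otherwise there are the 6 edges of the \<open>K4\<close> and one edge to 0 for
  each agreeing pendant vertex.\<close>

lemma card_common_K4_star:
  assumes t: "(i, \<phi>) \<in> block_index m M L" and s: "(j, \<psi>) \<in> block_index m M L"
  shows "card (image (block_emb M L (i, \<phi>)) ` K4_star m \<inter> image (block_emb M L (j, \<psi>)) ` K4_star m)
    \<le> (if i = j then 6 + card (agreement m \<phi> \<psi>) else 0)"
proof -
  let ?D = "agreement m \<phi> \<psi>"
  let ?C = "{e \<in> K4_star m. e \<subseteq> {u. block_emb M L (i, \<phi>) u = block_emb M L (j, \<psi>) u}}"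
  have "card ?C \<le> (if i = j then 6 + card ?D else 0)"
  proof (cases "i = j")
    case True
    have "?C \<subseteq> {e. e \<subseteq> {..<4} \<and> card e = 2} \<union> (\<lambda>u. {0, u}) ` ?D"
    proof
      fix e assume e: "e \<in> ?C"
      then obtain x y where xy: "e = {x, y}" "x < y" "y < m + 4" "x = 0 \<or> y < 4"
        by (auto simp: K4_star_def)
      then have "y \<in> ?D \<or> y < 4" using e block_emb_eq_iff[of y m M L i \<phi> j \<psi>] by auto
      then show "e \<in> {e. e \<subseteq> {..<4} \<and> card e = 2} \<union> (\<lambda>u. {0, u}) ` ?D" using xy by auto
    qed
    then have "card ?C \<le> card ({e. e \<subseteq> {..<4::nat} \<and> card e = 2} \<union> (\<lambda>u. {0, u}) ` ?D)"
      by (intro card_mono) auto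
    also have "\<dots> \<le> card {e. e \<subseteq> {..<4::nat} \<and> card e = 2} + card ((\<lambda>u. {0, u}) ` ?D)"
      by (rule card_Un_le)
    also have "\<dots> \<le> 6 + card ?D"
      using card_image_le[of ?D "\<lambda>u. {0, u}"] by (simp add: n_subsets choose_two)
    finally show ?thesis using True by simp
  next
    case False
    have "?C = {}"
    proof (rule ccontr)
      assume "?C \<noteq> {}"
      then obtain x y where xy: "x < y" "y < m + 4" "x = 0 \<or> y < 4"
        "block_emb M L (i, \<phi>) x = block_emb M L (j, \<psi>) x" by (auto simp: K4_star_def)
      then show False using False block_emb_eq_iff[of x m M L i \<phi> j \<psi>] by (auto simp: agreement_def)
    qed
    then show ?thesis by (simp only: card.empty)
  qed
  then show ?thesis using block_emb_common_edges[OF t s K4_star_subset] by linarith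
qed

text \<open>A non-edge joins a pendant vertex to 1, 2 or 3, or joins two pendant vertices. For
  different quadruples the first kind cannot be shared; counting it all the same makes the bound
  independent of i and j.\<close>

lemma card_common_K4_star_compl:
  assumes t: "(i, \<phi>) \<in> block_index m M L" and s: "(j, \<psi>) \<in> block_index m M L"
  shows "card (image (block_emb M L (i, \<phi>)) ` K4_star_compl m \<inter> image (block_emb M L (j, \<psi>)) ` K4_star_compl m)
    \<le> 3 * card (agreement m \<phi> \<psi>) + (card (agreement m \<phi> \<psi>) choose 2)"
proof -
  let ?D = "agreement m \<phi> \<psi>"
  let ?C = "{e \<in> K4_star_compl m. e \<subseteq> {u. block_emb M L (i, \<phi>) u = block_emb M L (j, \<psi>) u}}"
  let ?X = "(\<lambda>(c, u). {c, u}) ` ({1, 2, 3} \<times> ?D)" and ?Y = "{e. e \<subseteq> ?D \<and> card e = 2}"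
  have "?C \<subseteq> ?X \<union> ?Y"
  proof
    fix e assume e: "e \<in> ?C"
    then obtain a b where ab: "e = {a, b}" "a < m + 4" "b < m + 4" "a \<noteq> b" "e \<notin> K4_star m"
      by (auto simp: K4_star_compl_def all_edges_def)
    have "e = {min a b, max a b}" "min a b < max a b" "max a b < m + 4"
      using ab by (auto simp: min_def max_def)
    then obtain x y where xy: "e = {x, y}" "x < y" "y < m + 4" by blast
    then have ne: "x \<noteq> 0" "y \<ge> 4" using ab K4_star_iff[of x y m] by auto
    have yD: "y \<in> ?D" using e xy ne block_emb_eq_iff[of y m M L i \<phi> j \<psi>] by auto
    have xD: "x \<in> ?D \<or> x < 4" using e xy ne block_emb_eq_iff[of x m M L i \<phi> j \<psi>] by auto
    show "e \<in> ?X \<union> ?Y"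
    proof (cases "x < 4")
      case True
      then have "(x, y) \<in> {1, 2, 3} \<times> ?D" using ne yD by auto
      then show ?thesis using xy by (intro UnI1 image_eqI[of _ _ "(x, y)"]) auto
    next
      case False
      then show ?thesis using xD yD xy by auto
    qed
  qed
  then have "card ?C \<le> card (?X \<union> ?Y)" by (intro card_mono) auto
  also have "\<dots> \<le> card ?X + card ?Y" by (rule card_Un_le)
  also have "card ?X \<le> 3 * card ?D"
    using card_image_le[of "{1, 2, 3::nat} \<times> ?D" "\<lambda>(c, u). {c, u}"] by (simp add: card_cartesian_product)
  also have "card ?Y = card ?D choose 2" by (simp add: n_subsets)
  finally show ?thesis
    using block_emb_common_edges[OF t s, of "K4_star_compl m"] by (simp add: K4_star_compl_def)
qed

text \<open>The power is a product over coordinates, so the sum over the product space factorizes.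
  In each coordinate one value agrees and contributes x, the other L - 1 contribute 1.\<close>

lemma sum_power_agreement:
  fixes x :: real
  assumes "\<phi> \<in> {4..<m + 4} \<rightarrow>\<^sub>E {..<L}"
  shows "(\<Sum>\<psi>\<in>{4..<m + 4} \<rightarrow>\<^sub>E {..<L}. x ^ card (agreement m \<phi> \<psi>)) = (real L - 1 + x) ^ m"
proof -
  have "x ^ card (agreement m \<phi> \<psi>) = (\<Prod>u\<in>{4..<m + 4}. if \<psi> u = \<phi> u then x else 1)" for \<psi>
    unfolding agreement_def
    by (subst prod.inter_filter[symmetric]) (auto intro!: arg_cong2[where f=power] arg_cong[where f=card])
  then have "(\<Sum>\<psi>\<in>{4..<m + 4} \<rightarrow>\<^sub>E {..<L}. x ^ card (agreement m \<phi> \<psi>))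
      = (\<Prod>u\<in>{4..<m + 4}. \<Sum>v<L. if v = \<phi> u then x else 1)"
    by (subst prod_sum_PiE) auto
  also have "\<dots> = (\<Prod>u\<in>{4..<m + 4}. real L - 1 + x)"
  proof (rule prod.cong)
    fix u assume "u \<in> {4..<m + 4}"
    then have u: "\<phi> u < L" using assms by auto
    have "(\<Sum>v<L. if v = \<phi> u then x else 1) = (\<Sum>v<L. 1 + (if v = \<phi> u then x - 1 else 0))"
      by (intro sum.cong) auto
    then show "(\<Sum>v<L. if v = \<phi> u then x else 1) = real L - 1 + x"
      using u by (simp add: sum.distrib)
  qed simp
  finally show ?thesis by simp
qed

text \<open>Second moment method for the block embeddings: the correlation sum is at most (M - 1 +
  1/p^6) (L - 1 + y)^m, to be compared with M L^m embeddings. Hypothesis \<open>small\<close> is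
  this comparison after 1 + t \<le> exp t.\<close>

lemma gnp_prob_K4_star_gt_half:
  fixes p :: real
  assumes p: "0 < p" "p < 1" and sizes: "0 < M" "0 < L" "4 * M + m * L \<le> n"
    and small: "exp (real m * (1/(1-p)) powr (real m / 2) / (p * (1-p)^3 * real L))
      * (1 + 1 / (p^6 * real M)) < 2"
  shows "gnp_prob n p (good_event TYPE(real^3) True n (m + 4)) > 1/2"
proof -
  define T where "T = block_index m M L"
  define A where "A t = image (block_emb M L t) ` K4_star m" for t
  define B where "B t = image (block_emb M L t) ` K4_star_compl m" for t
  define \<Phi> where "\<Phi> = {4..<m + 4} \<rightarrow>\<^sub>E {..<L}"
  define z where "z = (1/(1-p)) powr (real m / 2)"
  define y where "y = z / (p * (1-p)^3)"
  have z: "z > 0" using p by (simp add: z_def)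
  have y: "y > 0" using p z by (simp add: y_def)
  have T_eq: "T = {..<M} \<times> \<Phi>" by (simp add: T_def block_index_def \<Phi>_def)
  have fin: "finite \<Phi>" by (simp add: \<Phi>_def finite_PiE)
  have cardPhi: "card \<Phi> = L ^ m" by (simp add: \<Phi>_def card_PiE)
  have compl: "K4_star_compl m \<subseteq> all_edges (m + 4)" by (auto simp: K4_star_compl_def)
  have inj: "inj_on (image (block_emb M L t)) (all_edges (m + 4))" if "t \<in> T" for t
    using that by (intro inj_on_image_edges inj_on_block_emb) (simp add: T_def)
  have AB: "A t \<union> B t = image (block_emb M L t) ` all_edges (m + 4)" for t
    using K4_star_subset[of m] by (auto simp: A_def B_def K4_star_compl_def)
  have sub: "image (block_emb M L t) ` all_edges (m + 4) \<subseteq> all_edges n" if "t \<in> T" for t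
    using that sizes by (intro all_edges_image inj_on_block_emb block_emb_less) (auto simp: T_def)
  have dis: "A t \<inter> B t = {}" if "t \<in> T" for t
    using inj_on_image_Int[OF inj[OF that] K4_star_subset compl]
    by (simp add: A_def B_def K4_star_compl_def)
  have corr: "(\<Sum>s\<in>T. (1/p) ^ card (A t \<inter> A s) * (1/(1-p)) ^ card (B t \<inter> B s)) < real (2 * card T)"
    if "t \<in> T" for t
  proof -
    obtain i \<phi> where t: "t = (i, \<phi>)" "i < M" "\<phi> \<in> \<Phi>" using \<open>t \<in> T\<close> by (auto simp: T_eq)
    have summand: "(1/p) ^ card (A t \<inter> A (j, \<psi>)) * (1/(1-p)) ^ card (B t \<inter> B (j, \<psi>))
        \<le> (if i = j then 1/p^6 else 1) * y ^ card (agreement m \<phi> \<psi>)"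
      if s: "(j, \<psi>) \<in> T" for j \<psi>
    proof -
      define l where "l = card (agreement m \<phi> \<psi>)"
      have "l \<le> card {4..<m + 4}" unfolding l_def by (rule card_mono) (auto simp: agreement_def)
      then have l: "l \<le> m" by simp
      have "(1/p) ^ card (A t \<inter> A (j, \<psi>)) \<le> (1/p) ^ (if i = j then 6 + l else 0)"
        using card_common_K4_star[of i \<phi> m M L j \<psi>] that \<open>t \<in> T\<close> p
        by (intro power_increasing) (auto simp: T_def A_def t l_def)
      \<comment> \<open>For different quadruples the factor (1/p)^l \<ge> 1 is given away, so that
        both cases depend on l in the same way.\<close>
      also have "\<dots> \<le> (if i = j then 1/p^6 else 1) * (1/p) ^ l"
        using p by (auto simp: power_add power_one_over intro: power_le_one)
      finally have 1: "(1/p) ^ card (A t \<inter> A (j, \<psi>)) \<le> (if i = j then 1/p^6 else 1) * (1/p) ^ l" .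
      have "(1/(1-p)) ^ card (B t \<inter> B (j, \<psi>)) \<le> (1/(1-p)) ^ (3 * l + (l choose 2))"
        using card_common_K4_star_compl[of i \<phi> m M L j \<psi>] that \<open>t \<in> T\<close> p
        by (intro power_increasing) (auto simp: T_def B_def t l_def)
      also have "\<dots> = ((1/(1-p)) ^ 3) ^ l * (1/(1-p)) powr (real (l choose 2))"
        using p by (simp add: power_add power_mult powr_realpow)
      \<comment> \<open>Replacing the quadratic exponent by one linear in l, via l \<le> m, leaves
        the l-th power of a fixed number, as \<open>sum_power_agreement\<close> requires.\<close>
      also have "(1/(1-p)) powr (real (l choose 2)) \<le> (1/(1-p)) powr (real m / 2 * real l)"
      proof (rule powr_mono)
        have "real (l choose 2) \<le> real (l * (l - 1)) / 2"
          using of_nat_div_le_of_nat[where 'a=real, of "l * (l - 1)" 2] by (simp add: choose_two)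
        also have "\<dots> \<le> real (m * l) / 2"
          using l by (intro divide_right_mono of_nat_mono) (auto intro: mult_le_mono simp: mult.commute)
        finally show "real (l choose 2) \<le> real m / 2 * real l" by simp
      qed (use p in simp)
      also have "(1/(1-p)) powr (real m / 2 * real l) = z ^ l"
        using powr_realpow[OF z, of l] by (simp only: z_def powr_powr)
      finally have 2: "(1/(1-p)) ^ card (B t \<inter> B (j, \<psi>)) \<le> ((1/(1-p)) ^ 3) ^ l * z ^ l"
        using p by (simp add: mult_left_mono)
      have "(1/p) ^ card (A t \<inter> A (j, \<psi>)) * (1/(1-p)) ^ card (B t \<inter> B (j, \<psi>))
        \<le> ((if i = j then 1/p^6 else 1) * (1/p) ^ l) * (((1/(1-p)) ^ 3) ^ l * z ^ l)"
        using p by (intro mult_mono 1 2) auto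
      also have "\<dots> = (if i = j then 1/p^6 else 1) * y ^ l"
        by (simp add: y_def power_mult_distrib power_divide power_one_over)
      finally show ?thesis by (simp add: l_def)
    qed
    have "(\<Sum>s\<in>T. (1/p) ^ card (A t \<inter> A s) * (1/(1-p)) ^ card (B t \<inter> B s))
      \<le> (\<Sum>(j, \<psi>)\<in>T. (if i = j then 1/p^6 else 1) * y ^ card (agreement m \<phi> \<psi>))"
      using summand by (intro sum_mono) auto
    also have "\<dots> = (\<Sum>j<M. if i = j then 1/p^6 else 1) * (\<Sum>\<psi>\<in>\<Phi>. y ^ card (agreement m \<phi> \<psi>))"
      unfolding T_eq by (simp add: sum_product sum.cartesian_product)
    also have "(\<Sum>j<M. if i = j then 1/p^6 else 1) = (\<Sum>j<M. 1 + (if i = j then 1/p^6 - 1 else 0))"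
      by (intro sum.cong) auto
    also have "\<dots> = real M - 1 + 1/p^6" using t by (simp add: sum.distrib)
    also have "(\<Sum>\<psi>\<in>\<Phi>. y ^ card (agreement m \<phi> \<psi>)) = (real L - 1 + y) ^ m"
      using sum_power_agreement t by (simp add: \<Phi>_def)
    also have "(real M - 1 + 1/p^6) * (real L - 1 + y) ^ m
      \<le> (real M * (1 + 1 / (p^6 * real M))) * (real L ^ m * exp (real m * (y / real L)))"
    proof (rule mult_mono)
      show "real M - 1 + 1/p^6 \<le> real M * (1 + 1 / (p^6 * real M))"
        using sizes p by (simp add: field_simps)
      have "(real L - 1 + y) ^ m \<le> (real L * (1 + y / real L)) ^ m"
        using sizes y by (intro power_mono) (auto simp: field_simps)
      also have "\<dots> = real L ^ m * (1 + y / real L) ^ m" by (rule power_mult_distrib)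
      also have "(1 + y / real L) ^ m \<le> exp (y / real L) ^ m"
        using sizes y by (intro power_mono exp_ge_add_one_self) auto
      also have "exp (y / real L) ^ m = exp (real m * (y / real L))"
        by (rule exp_of_nat_mult[symmetric])
      finally show "(real L - 1 + y) ^ m \<le> real L ^ m * exp (real m * (y / real L))"
        by (simp add: mult_left_mono)
    qed (use sizes y p in auto)
    also have "\<dots> = (real M * real L ^ m) * (exp (real m * (y / real L)) * (1 + 1 / (p^6 * real M)))"
      by simp
    also have "\<dots> < (real M * real L ^ m) * 2"
      using small sizes by (intro mult_strict_left_mono) (auto simp: y_def z_def mult.assoc)
    also have "\<dots> = real (2 * card T)" by (simp add: T_eq card_cartesian_product cardPhi)
    finally show ?thesis .
  qed
  have "gnp_prob n p (\<lambda>E. \<exists>t\<in>T. A t \<subseteq> E \<and> B t \<inter> E = {}) > 1/2"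
  proof (rule gnp_prob_exists_gt_half[OF p])
    show "finite T" using fin by (simp add: T_eq)
    show "T \<noteq> {}" using sizes by (auto simp: T_eq \<Phi>_def PiE_eq_empty_iff)
    show "A t \<subseteq> all_edges n" "B t \<subseteq> all_edges n" if "t \<in> T" for t
      using sub[OF that] unfolding AB[of t, symmetric] by simp_all
    show "card (A t) = card (K4_star m)" if "t \<in> T" for t
      unfolding A_def by (rule card_image[OF inj_on_subset[OF inj[OF that] K4_star_subset]])
    show "card (B t) = card (K4_star_compl m)" if "t \<in> T" for t
      unfolding B_def by (rule card_image[OF inj_on_subset[OF inj[OF that] compl]])
  qed (use dis corr in auto)
  also have "gnp_prob n p (\<lambda>E. \<exists>t\<in>T. A t \<subseteq> E \<and> B t \<inter> E = {})
      \<le> gnp_prob n p (good_event TYPE(real^3) True n (m + 4))"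
  proof (rule gnp_prob_mono)
    fix E assume E: "E \<subseteq> all_edges n" "\<exists>t\<in>T. A t \<subseteq> E \<and> B t \<inter> E = {}"
    then obtain t where t: "t \<in> T" "A t \<subseteq> E" "B t \<inter> E = {}" by auto
    define g where "g = block_emb M L t"
    have g: "inj_on g {..<m + 4}" using t by (auto simp: g_def T_def intro: inj_on_block_emb)
    have gn: "g u < n" if "u < m + 4" for u
      using block_emb_less t sizes that by (auto simp: g_def T_def)
    \<comment> \<open>\<open>A t\<close> and \<open>B t\<close> together exhaust the pairs inside
      the image; as \<open>E\<close> avoids \<open>B t\<close>, the copy is induced.\<close>
    have "induced_edges E (g ` {..<m + 4}) = image g ` K4_star m"
    proof
      show "induced_edges E (g ` {..<m + 4}) \<subseteq> image g ` K4_star m"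
      proof
        fix e assume "e \<in> induced_edges E (g ` {..<m + 4})"
        then have e: "e \<in> E" "e \<subseteq> g ` {..<m + 4}" by (auto simp: induced_edges_def)
        then obtain a b where "a \<noteq> b" "e = {a, b}" using E by (auto simp: all_edges_def)
        then obtain x y where xy: "x < m + 4" "y < m + 4" "x \<noteq> y" "e = g ` {x, y}" using e by auto
        then have "{x, y} \<in> all_edges (m + 4)" unfolding all_edges_def by blast
        then have "e \<in> image g ` all_edges (m + 4)" unfolding xy(4) by (rule imageI)
        then have "e \<in> A t \<union> B t" using AB by (simp add: g_def)
        then show "e \<in> image g ` K4_star m" using e t by (auto simp: A_def g_def)
      qed
      show "image g ` K4_star m \<subseteq> induced_edges E (g ` {..<m + 4})"
      proof
        fix e assume e: "e \<in> image g ` K4_star m"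
        then have "e \<in> E" using t by (auto simp: A_def g_def)
        then show "e \<in> induced_edges E (g ` {..<m + 4})"
          using e by (auto simp: induced_edges_def K4_star_def)
      qed
    qed
    note copy = K4_star_copy_good[OF g this]
    show "good_event TYPE(real^3) True n (m + 4) E"
      unfolding good_event_def
      by (rule exI[of _ "g ` {..<m + 4}"]) (use copy gn card_image[OF g] in auto)
  qed (use p in auto)
  finally show ?thesis .
qed

section \<open>Asymptotics\<close>

text \<open>No \<open>W\<close> has more than n vertices, so the set under \<open>Max\<close> is
  finite and its maximum is meaningful.\<close>

lemma u_gen_ge:
  assumes "gnp_prob n p (good_event T conn n k) > 1/2" "k > 0"
  shows "k \<le> u_gen T conn n p"
proof -
  let ?S = "{k. k > 0 \<and> gnp_prob n p (good_event T conn n k) > 1/2}"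
  have "?S \<subseteq> {..n}"
  proof
    fix j assume j: "j \<in> ?S"
    have "\<exists>E. good_event T conn n j E"
    proof (rule ccontr)
      assume "\<not> ?thesis"
      then have "gnp_prob n p (good_event T conn n j) = 0" by (simp add: gnp_prob_def)
      then show False using j by simp
    qed
    then obtain W where "W \<subseteq> {..<n}" "card W = j" by (auto simp: good_event_def)
    then show "j \<in> {..n}" using card_mono[of "{..<n}" W] by simp
  qed
  then have "finite ?S" by (rule finite_subset) simp
  then have "k \<le> Max ?S" using assms by (intro Max_ge) auto
  then show ?thesis using assms by (auto simp: u_gen_def)
qed

text \<open>All growth conditions are measured on one scale a = n^(\<epsilon>/64), which bounds 1/p,
  1/q and ln n while a^64 \<le> n. Then m = O(a^2) and q^(-m/2) \<le> np / a^16, and it remains to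
  count powers of a.\<close>

lemma gnp_prob_K4_star_large:
  fixes p :: real and n :: nat
  assumes \<epsilon>: "0 < \<epsilon>" "\<epsilon> \<le> 1" and p: "0 < p" "p < 1"
    and a: "a = real n powr (\<epsilon> / 64)" "a \<ge> 1000"
    and pa: "p * a \<ge> 1" and qa: "(1 - p) * a \<ge> 1" and la: "ln (real n) \<le> a"
    and m: "real m \<le> (2 - \<epsilon>) * log (1 / (1 - p)) (real n * p)"
  shows "gnp_prob n p (good_event TYPE(real^3) True n (m + 4)) > 1/2"
proof -
  define q where "q = 1 - p"
  \<comment> \<open>Quadruples and blocks each take at most half of the vertices; m + 1 in
    \<open>L\<close> avoids division by zero when m = 0.\<close>
  define M where "M = n div 8"
  define L where "L = n div (2 * (m + 1))"
  have q: "0 < q" "q < 1" using p by (auto simp: q_def)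
  have n: "real n \<ge> 1"
    using a by (cases "n = 0") auto
  have an: "a ^ 64 \<le> real n"
  proof -
    have "a ^ 64 = real n powr \<epsilon>"
      using a n by (simp add: powr_realpow[symmetric] powr_powr)
    also have "\<dots> \<le> real n powr 1" using \<epsilon> n by (intro powr_mono) auto
    finally show ?thesis using n by simp
  qed
  have mono: "a ^ i \<le> a ^ j" if "i \<le> j" for i j
    using that a by (intro power_increasing) auto
  have ip: "1 / p \<le> a" "1 / q \<le> a" using pa qa p q by (auto simp: field_simps q_def)
  have np: "real n * p \<ge> sqrt (real n)"
  proof -
    have "a\<^sup>2 \<le> real n" using an mono[of 2 64] by linarith
    then have "a \<le> sqrt (real n)" by (rule real_le_rsqrt)
    then have "1 / p \<le> sqrt (real n)" using ip by linarith
    then have "1 \<le> sqrt (real n) * p" using p by (simp add: field_simps)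
    then have "sqrt (real n) * 1 \<le> sqrt (real n) * (sqrt (real n) * p)" by (intro mult_left_mono) auto
    then show ?thesis by (simp flip: mult.assoc)
  qed
  have np1: "real n * p \<ge> 1" using np n real_sqrt_ge_one[of "real n"] by linarith
  \<comment> \<open>From ln q \<le> q - 1; it bounds logarithms to base 1/q by natural ones divided
    by p.\<close>
  have lnq: "ln (1 / q) \<ge> p" "ln (1 / q) > 0"
    using q ln_le_minus_one[of q] by (auto simp: ln_div q_def)
  have m_ln: "real m * ln (1 / q) \<le> (2 - \<epsilon>) * ln (real n * p)"
    using m lnq by (simp add: log_def q_def[symmetric] field_simps)
  have m_le: "real m \<le> 2 * a\<^sup>2"
  proof -
    have "ln (real n * p) \<le> ln (real n)" using n p np1 by (intro ln_mono) auto
    then have "ln (real n * p) \<le> a" using la by linarith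
    moreover have "ln (real n * p) \<ge> 0" using np1 by simp
    ultimately have "(2 - \<epsilon>) * ln (real n * p) \<le> 2 * a" using \<epsilon> by (intro mult_mono) auto
    moreover have "real m * p \<le> real m * ln (1 / q)" using lnq by (intro mult_left_mono) auto
    ultimately have "real m * p \<le> 2 * a" using m_ln by linarith
    then have "real m \<le> 2 * a * (1 / p)" using p by (simp add: field_simps)
    also have "\<dots> \<le> 2 * a * a" using ip a by (intro mult_left_mono) auto
    finally show ?thesis by (simp add: power2_eq_square)
  qed
  have m1_le: "real m + 1 \<le> 3 * a\<^sup>2"
    using m_le mono[of 0 2] by simp
  have "a ^ 3 = a * a\<^sup>2" by (simp add: power3_eq_cube power2_eq_square)
  also have "\<dots> \<ge> 1000 * a\<^sup>2" using a by (intro mult_right_mono) auto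
  finally have a3: "1000 * a\<^sup>2 \<le> real n" using an mono[of 3 64] by linarith
  \<comment> \<open>Rounding down loses less than 1, which is at most half of n/d \<ge> 2.\<close>
  have div_ge: "real (n div d) \<ge> real n / (2 * real d)" if "0 < d" "2 * d \<le> n" for d
  proof -
    have "n < d + d * (n div d)" using that by (intro dividend_less_times_div)
    then have "real n < real d + real d * real (n div d)" by (simp flip: of_nat_add of_nat_mult)
    then have "real n / real d < real (n div d) + 1" using that by (simp add: field_simps)
    moreover have "real n / real d \<ge> 2" using that by (simp add: field_simps flip: of_nat_mult)
    moreover have "real n / (2 * real d) = real n / real d / 2" by simp
    ultimately show ?thesis by linarith
  qed
  have n_m: "4 * (m + 1) \<le> n"
  proof -
    have "4 * (real m + 1) \<le> real n" using m1_le a3 mono[of 0 2] by simp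
    then have "real (4 * (m + 1)) \<le> real n" by simp
    then show ?thesis by (simp only: of_nat_le_iff)
  qed
  have L_ge: "real L \<ge> real n / (12 * a\<^sup>2)"
  proof -
    have "real n / (12 * a\<^sup>2) \<le> real n / (4 * (real m + 1))"
      using m1_le by (intro divide_left_mono mult_pos_pos) auto
    also have "\<dots> = real n / (2 * real (2 * (m + 1)))" by simp
    also have "\<dots> \<le> real L" unfolding L_def by (rule div_ge) (use n_m in auto)
    finally show ?thesis .
  qed
  have L0: "real L > 0"
  proof -
    have "real n / (12 * a\<^sup>2) > 0" using a n by simp
    then show ?thesis using L_ge by linarith
  qed
  have n16: "16 \<le> n" using a3 mono[of 0 2] by simp
  have M_ge: "real M \<ge> real n / 16" unfolding M_def using div_ge[of 8] n16 by simp
  have M0: "real M > 0" using M_ge n by linarith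
  have sum_le: "4 * M + m * L \<le> n"
  proof -
    have "8 * M \<le> n" by (simp add: M_def)
    moreover have "(2 * (m + 1)) * L \<le> n" unfolding L_def by (rule times_div_less_eq_dividend)
    ultimately show ?thesis by (simp add: algebra_simps)
  qed
  define z where "z = (1 / q) powr (real m / 2)"
  have z_le: "z \<le> real n * p / a ^ 16"
  proof -
    have "ln z = real m * ln (1 / q) / 2" using q by (simp add: z_def ln_powr)
    also have "\<dots> \<le> (1 - \<epsilon>/2) * ln (real n * p)" using m_ln by (simp add: field_simps)
    also have "\<dots> = ln (real n * p) - \<epsilon>/2 * ln (real n * p)" by (simp add: algebra_simps)
    also have "\<dots> \<le> ln (real n * p) - \<epsilon>/2 * ln (sqrt (real n))"
      using np n \<epsilon> np1 by (intro diff_left_mono mult_left_mono ln_mono) auto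
    \<comment> \<open>Here \<epsilon>/2 * 1/2 = 16 * \<epsilon>/64: the \<epsilon> in the bound on m
      gains a factor a^16.\<close>
    also have "\<epsilon>/2 * ln (sqrt (real n)) = ln (a ^ 16)"
      using n a by (simp add: ln_sqrt ln_realpow ln_powr)
    also have "ln (real n * p) - ln (a ^ 16) = ln (real n * p / a ^ 16)"
      using np1 a by (subst ln_div) auto
    finally show ?thesis
      using np1 a q n p by (subst (asm) ln_le_cancel_iff) (auto simp: z_def)
  qed
  have x_le: "real m * z / (p * q^3 * real L) \<le> 24 / a"
  proof -
    have "real m * z / (p * q^3 * real L) = real m * z * (1/p) * (1/q)^3 * (1 / real L)"
      by (simp add: power_one_over)
    \<comment> \<open>The factors n and p cancel, leaving 24 a^(2+3+2) / a^16.\<close>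
    also have "\<dots> \<le> (2 * a\<^sup>2) * (real n * p / a ^ 16) * (1/p) * a^3 * (12 * a\<^sup>2 / real n)"
    proof (intro mult_mono power_mono m_le z_le order_refl ip)
      show "1 / real L \<le> 12 * a\<^sup>2 / real n"
        using L_ge L0 n a by (simp add: field_simps)
    qed (use a p q n L0 z_def in auto)
    also have "\<dots> = 24 * a ^ 7 / a ^ 16"
      using n p by (simp add: field_simps eval_nat_numeral)
    also have "\<dots> = 24 / a ^ 9" using a(2) by (subst frac_eq_eq) (auto simp flip: power_add)
    also have "\<dots> \<le> 24 / a" using mono[of 1 9] a(2) by (intro divide_left_mono mult_pos_pos) auto
    finally show ?thesis .
  qed
  have y_le: "1 / (p^6 * real M) \<le> 16 / a"
  proof -
    have "1 / (p^6 * real M) = (1/p)^6 * (1 / real M)" by (simp add: power_one_over)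
    also have "\<dots> \<le> a^6 * (16 / real n)"
    proof (intro mult_mono power_mono ip)
      show "1 / real M \<le> 16 / real n" using M_ge M0 n by (simp add: field_simps)
    qed (use a p M0 in auto)
    also have "\<dots> \<le> 16 / a"
    proof -
      have "a ^ 6 * a \<le> real n" using an mono[of 7 64] by (simp add: eval_nat_numeral)
      then show ?thesis using a(2) n by (simp add: field_simps)
    qed
    finally show ?thesis .
  qed
  have small_a: "24 / a \<le> 1/10" "16 / a \<le> 1/10" using a(2) by (auto simp: field_simps)
  have "exp (real m * z / (p * q^3 * real L)) * (1 + 1 / (p^6 * real M)) \<le> exp (1/10) * (1 + 1/10)"
  proof (rule mult_mono)
    show "exp (real m * z / (p * q^3 * real L)) \<le> exp (1/10)"
      using order_trans[OF x_le small_a(1)] by (simp only: exp_le_cancel_iff)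
    show "1 + 1 / (p^6 * real M) \<le> 1 + 1/10" using order_trans[OF y_le small_a(2)] by linarith
  qed (use p in auto)
  also have "\<dots> \<le> (1 + 2 * (1/10)) * (1 + 1/10)"
    by (intro mult_right_mono real_exp_bound_lemma) auto
  also have "\<dots> < 2" by simp
  finally have "exp (real m * z / (p * q^3 * real L)) * (1 + 1 / (p^6 * real M)) < 2" .
  then show ?thesis
    using gnp_prob_K4_star_gt_half[OF p _ _ sum_le] M0 L0 by (simp add: z_def q_def)
qed

theorem theorem22:
  fixes p :: "nat \<Rightarrow> real"
  assumes prob: "\<And>n. 0 \<le> p n \<and> p n \<le> 1"
    and dense: "\<And>\<alpha>::real. \<alpha> > 0 \<Longrightarrow> filterlim (\<lambda>n. p n * real n powr \<alpha>) at_top sequentially"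
    and qlog: "filterlim (\<lambda>n. (1 - p n) * ln (real n)) at_top sequentially"
  shows "\<forall>\<epsilon>>0. \<exists>n0. \<forall>n\<ge>n0.
     real (u_d TYPE(real^3) n (p n)) \<ge> (2 - \<epsilon>) * log (1 / (1 - p n)) (real n * p n) \<and>
     real (u_d' TYPE(real^3) n (p n)) \<ge> (2 - \<epsilon>) * log (1 / (1 - p n)) (real n * p n)"
proof (intro allI impI)
  fix \<epsilon> :: real assume "\<epsilon> > 0"
  \<comment> \<open>Capping at 1 keeps 2 - \<delta> positive; for larger \<epsilon> the claim is
    weaker once the logarithm is nonnegative.\<close>
  define \<delta> where "\<delta> = min \<epsilon> 1"
  have \<delta>: "0 < \<delta>" "\<delta> \<le> 1" "\<delta> \<le> \<epsilon>" using \<open>\<epsilon> > 0\<close> by (auto simp: \<delta>_def)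
  define a where "a n = real n powr (\<delta> / 64)" for n
  \<comment> \<open>Since p \<le> 1, this also yields a \<ge> 1000. The next two facts combine to q
    a \<ge> 1.\<close>
  have "eventually (\<lambda>n. p n * a n \<ge> 1000) sequentially"
    using dense[of "\<delta> / 64"] \<delta> by (simp add: filterlim_at_top a_def)
  moreover have "eventually (\<lambda>n. (1 - p n) * ln (real n) \<ge> 1) sequentially"
    using qlog by (simp add: filterlim_at_top)
  moreover have "eventually (\<lambda>n. ln (real n) \<le> a n) sequentially"
  proof -
    have "((\<lambda>n. ln (real n) / real n powr (\<delta> / 64)) \<longlongrightarrow> 0) sequentially"
      using \<delta> by (intro lim_ln_over_power) auto
    then have "eventually (\<lambda>n. ln (real n) / real n powr (\<delta> / 64) < 1) sequentially"
      by (rule order_tendstoD) simp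
    moreover have "eventually (\<lambda>n. n > 0) sequentially" by (rule eventually_gt_at_top)
    ultimately show ?thesis
      by eventually_elim (simp add: a_def divide_less_eq)
  qed
  moreover have "eventually (\<lambda>n. n \<ge> 1) sequentially" by (rule eventually_ge_at_top)
  ultimately have "eventually (\<lambda>n.
      real (u_d TYPE(real^3) n (p n)) \<ge> (2 - \<epsilon>) * log (1 / (1 - p n)) (real n * p n) \<and>
      real (u_d' TYPE(real^3) n (p n)) \<ge> (2 - \<epsilon>) * log (1 / (1 - p n)) (real n * p n)) sequentially"
  proof eventually_elim
    case (elim n)
    define x where "x = log (1 / (1 - p n)) (real n * p n)"
    define m where "m = nat \<lfloor>(2 - \<delta>) * x\<rfloor>"
    have p0: "0 < p n" using prob[of n] elim(1) by (cases "p n = 0") auto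
    have p1: "p n < 1" using prob[of n] elim(2) by (cases "p n = 1") auto
    have pa: "p n * a n \<ge> 1" using elim(1) by linarith
    have "p n * a n \<le> 1 * a n" using prob[of n] by (intro mult_right_mono) (auto simp: a_def)
    then have a1000: "a n \<ge> 1000" using elim(1) by linarith
    have qa: "(1 - p n) * a n \<ge> 1"
      by (rule order_trans[OF elim(2)]) (use elim(3) p1 in \<open>simp add: mult_left_mono\<close>)
    have "real n powr (\<delta> / 64) \<le> real n powr 1"
      using elim(4) \<delta> by (intro powr_mono) auto
    then have "p n * a n \<le> p n * real n" using p0 by (intro mult_left_mono) (auto simp: a_def)
    then have "real n * p n \<ge> 1" using pa by (simp add: mult.commute)
    then have x0: "x \<ge> 0" unfolding x_def using p0 p1 by (subst zero_le_log_cancel_iff) (auto simp: field_simps)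
    then have "(2 - \<delta>) * x \<ge> 0" using \<delta> by simp
    \<comment> \<open>The four vertices of the \<open>K4\<close> more than make up for rounding
      down.\<close>
    then have m: "real m \<le> (2 - \<delta>) * x" "(2 - \<delta>) * x \<le> real m + 4"
      unfolding m_def by linarith+
    have good: "gnp_prob n (p n) (good_event TYPE(real^3) True n (m + 4)) > 1/2"
      by (rule gnp_prob_K4_star_large[OF \<delta>(1,2) p0 p1 a_def a1000 pa qa elim(3)])
        (use m in \<open>simp add: x_def\<close>)
    \<comment> \<open>Dropping connectedness only enlarges the event, so one construction serves
      both quantities.\<close>
    also have "gnp_prob n (p n) (good_event TYPE(real^3) True n (m + 4))
        \<le> gnp_prob n (p n) (good_event TYPE(real^3) False n (m + 4))"
      using prob by (intro gnp_prob_mono) (auto simp: good_event_def)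
    finally have good': "gnp_prob n (p n) (good_event TYPE(real^3) False n (m + 4)) > 1/2" .
    have "(2 - \<epsilon>) * x \<le> (2 - \<delta>) * x" using \<delta> x0 by (intro mult_right_mono) auto
    then have le: "(2 - \<epsilon>) * x \<le> real (m + 4)" using m by simp
    have "real (m + 4) \<le> real (u_gen TYPE(real^3) c n (p n))" for c
      using u_gen_ge[OF good] u_gen_ge[OF good'] by (intro of_nat_mono) (cases c; simp)
    then show ?case using le unfolding u_d_def u_d'_def x_def[symmetric] by (meson order_trans)
  qed
  then show "\<exists>n0. \<forall>n\<ge>n0.
     real (u_d TYPE(real^3) n (p n)) \<ge> (2 - \<epsilon>) * log (1 / (1 - p n)) (real n * p n) \<and>
     real (u_d' TYPE(real^3) n (p n)) \<ge> (2 - \<epsilon>) * log (1 / (1 - p n)) (real n * p n)"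
    by (simp add: eventually_sequentially)
qed

end
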